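(* Let $p=(12,R)$ be the mesh pattern with $R=\{(0,0),(0,1),(1,0),(1,1),(1,2),(2,1)\}$. Let $T_{n,k}$ be the number of permutations in $S_n$ with exactly $k$ occurrences of $p$, and let $T_n(x)=\sum_{k=0}^{n-1}T_{n,k}x^k$. Then for all $n\ge 3$ and $k\ge0$, $$T_{n,k} = (k+1)T_{n-1,k+1}+(n-k)T_{n-1,k} -T_{n-2,k}+T_{n-2,k-1},$$ with the initial conditions $T_{1,0}=1$, $T_{2,0}=1$, $T_{2,1}=1$. Equivalently, for all $n\ge3$, $$T_n(x) = n T_{n-1}(x)+(1-x) T'_{n-1}(x)+(x-1)T_{n-2}(x),$$ with the initial conditions $T_1(x)=1$ and $T_2(x)=1+x$.
   Context: $S_n$ is the set of permutations $\pi=\pi_1\cdots\pi_n$ of $\{1,\dots,n\}$. A mesh pattern $(12,R)$ consists of the permutation $12$ and a set $R\subseteq\{0,1,2\}\times\{0,1,2\}$ of shaded boxes. An occurrence of $(12,R)$ in $\pi\in S_n$ is a pair of positions $s<t$ with $\pi_s<\pi_t$ such that, putting $s_0=0,\ s_1=s,\ s_2=t,\ s_3=n+1$ and $v_0=0,\ v_1=\pi_s,\ v_2=\pi_t,\ v_3=n+1$, for every $(i,j)\in R$ there is no position $m$ with $s_i<m<s_{i+1}$ and $v_j<\pi_m<v_{j+1}$. By convention $T_{n,-1}=0$. $T'_n(x)$ is the derivative of $T_n(x)$ with respect to $x$. *)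

theory Defs
  imports "HOL-Combinatorics.Permutations" "HOL-Computational_Algebra.Polynomial"
begin

text \<open>
  An element of \<open>S\<^sub>n\<close> is a function \<open>\<pi>\<close> with \<open>\<pi> permutes {1..n}\<close>, so that \<open>\<pi> m\<close> is the entry at
  position \<open>m\<close>. The mesh pattern \<open>(12, R)\<close> is represented by its set \<open>R\<close> of shaded boxes, a subset
  of \<open>{0..2} \<times> {0..2}\<close>; the box \<open>(i, j)\<close> has column \<open>i\<close> (positions) and row \<open>j\<close> (values). The
  lists below are \<open>[s\<^sub>0, s\<^sub>1, s\<^sub>2, s\<^sub>3]\<close> and \<open>[v\<^sub>0, v\<^sub>1, v\<^sub>2, v\<^sub>3]\<close>.
\<close>

definition mesh12_occurrences ::
    "(nat \<times> nat) set \<Rightarrow> nat \<Rightarrow> (nat \<Rightarrow> nat) \<Rightarrow> (nat \<times> nat) set" where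
  "mesh12_occurrences R n \<pi> =
     {(s, t). s \<in> {1..n} \<and> t \<in> {1..n} \<and> s < t \<and> \<pi> s < \<pi> t \<and>
        (\<forall>(i, j) \<in> R. \<not> (\<exists>m \<in> {1..n}.
           [0, s, t, n + 1] ! i < m \<and> m < [0, s, t, n + 1] ! (i + 1) \<and>
           [0, \<pi> s, \<pi> t, n + 1] ! j < \<pi> m \<and> \<pi> m < [0, \<pi> s, \<pi> t, n + 1] ! (j + 1)))}"

text \<open>
  The index \<open>k\<close> is an integer, so that the convention \<open>T\<^bsub>n,-1\<^esub> = 0\<close> holds automatically.
\<close>

definition mesh12_count :: "(nat \<times> nat) set \<Rightarrow> nat \<Rightarrow> int \<Rightarrow> nat" where
  "mesh12_count R n k =
     card {\<pi>. \<pi> permutes {1..n} \<and> int (card (mesh12_occurrences R n \<pi>)) = k}"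

definition mesh12_poly :: "(nat \<times> nat) set \<Rightarrow> nat \<Rightarrow> int poly" where
  "mesh12_poly R n = (\<Sum>k<n. monom (int (mesh12_count R n (int k))) k)"

end

theory Submission
  imports Defs
begin

text \<open>
  The shading forces an occurrence to be a pair of neighbouring positions \<open>s\<close> and \<open>s + 1\<close> (column 1
  is shaded completely) whose values are consecutive too (by row 1, which is shaded completely),
  with every earlier entry larger (by the box \<open>(0, 0)\<close>). So the statistic counts
  the \<open>s\<close> at which \<open>\<pi>\<close> has a left-to-right minimum followed by its successor value
  (\<open>mesh12_occurrences_eq\<close>).

  A permutation of \<open>{1..n+1}\<close> is a last entry \<open>j\<close> together with the permutation \<open>\<sigma>\<close> of \<open>{1..n}\<close>
  that has the same relative order as the other entries; it is recovered from \<open>\<sigma>\<close> by raising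
  all values \<open>\<ge> j\<close>. Raising keeps the left-to-right minima and destroys the succession at \<open>s\<close>
  exactly when \<open>j\<close> falls between the values \<open>\<sigma> s\<close> and \<open>\<sigma> s + 1\<close>. The appended entry creates a new
  occurrence exactly when it is the successor of an entry that is the minimum of all, that is, when
  \<open>\<sigma> n = 1\<close> and \<open>j = 2\<close> (\<open>min_successions_raise_from\<close>). Therefore, if \<open>\<sigma>\<close> has \<open>k\<close> occurrences, then
  \<open>k\<close> of the \<open>n + 1\<close> choices of \<open>j\<close> lead to \<open>k - 1\<close> occurrences and all others to \<open>k\<close>, except that
  \<open>j = 2\<close> leads to \<open>k + 1\<close> when \<open>\<sigma> n = 1\<close>. In terms of \<open>x ^ k\<close> this is
  \<open>(n + 1) x ^ k + (1 - x) k x ^ (k - 1)\<close>, corrected by \<open>(x - 1) x ^ k\<close> if \<open>\<sigma> n = 1\<close>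
  (\<open>sum_last_entry\<close>).

  The permutations that end in \<open>1\<close> are those with \<open>j = 1\<close>, which neither destroys nor creates
  an occurrence; so the correction terms sum to \<open>x - 1\<close> times the generating polynomial two
  sizes below (\<open>sum_last_entry_one\<close>). Summing over \<open>\<sigma>\<close> gives the recurrence for the polynomials,
  and comparing coefficients gives the one for the numbers.
\<close>

section \<open>Occurrences as successions at left-to-right minima\<close>

definition min_successions :: "nat \<Rightarrow> (nat \<Rightarrow> nat) \<Rightarrow> nat set" where
  "min_successions n \<pi> =
     {s \<in> {1..<n}. \<pi> (Suc s) = Suc (\<pi> s) \<and> (\<forall>m \<in> {1..<s}. \<pi> s < \<pi> m)}"

lemma finite_min_successions [simp]: "finite (min_successions n \<pi>)"
  by (simp add: min_successions_def)

text \<open>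
  The last position cannot carry a succession. This bound is why cutting the generating
  polynomial off below degree \<open>n\<close> loses nothing.
\<close>

lemma card_min_successions_less:
  assumes "n \<ge> 1"
  shows "card (min_successions n \<pi>) < n"
proof -
  have "card (min_successions n \<pi>) \<le> card {1..<n}"
    by (rule card_mono) (auto simp: min_successions_def)
  then show ?thesis
    using assms by simp
qed

text \<open>
  An entry at a position between \<open>s\<close> and \<open>t\<close> would lie in a box of column 1, so \<open>t = s + 1\<close>.
  If the values were not consecutive, the entry with value \<open>\<pi> s + 1\<close> would lie in row 1, left
  of \<open>s\<close> or right of \<open>t\<close>. The remaining box \<open>(0, 0)\<close> says that \<open>\<pi> s\<close> is a left-to-right minimum.
\<close>

lemma mesh12_occurrences_eq:
  assumes R: "R = {(0,0), (0,1), (1,0), (1,1), (1,2), (2,1)}"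
    and \<pi>: "\<pi> permutes {1..n}"
  shows "mesh12_occurrences R n \<pi> = (\<lambda>s. (s, Suc s)) ` min_successions n \<pi>"
proof -
  have range: "1 \<le> \<pi> m \<and> \<pi> m \<le> n" if "m \<in> {1..n}" for m
    using permutes_in_image[OF \<pi>, of m] that by simp
  have inj: "\<pi> a = \<pi> b \<longleftrightarrow> a = b" for a b
    using permutes_inj[OF \<pi>] by (auto dest: injD)
  have occ: "(s, t) \<in> mesh12_occurrences R n \<pi> \<longleftrightarrow>
      s \<in> {1..n} \<and> t \<in> {1..n} \<and> s < t \<and> \<pi> s < \<pi> t \<and>
      (\<forall>m \<in> {1..n}. \<not> (m < s \<and> \<pi> m < \<pi> s) \<and> \<not> (m < s \<and> \<pi> s < \<pi> m \<and> \<pi> m < \<pi> t) \<and>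
         \<not> (s < m \<and> m < t \<and> \<pi> m < \<pi> s) \<and> \<not> (s < m \<and> m < t \<and> \<pi> s < \<pi> m \<and> \<pi> m < \<pi> t) \<and>
         \<not> (s < m \<and> m < t \<and> \<pi> t < \<pi> m) \<and> \<not> (t < m \<and> \<pi> s < \<pi> m \<and> \<pi> m < \<pi> t))" for s t
  proof -
    have [simp]: "0 < \<pi> m" "\<pi> m < Suc n" if "m \<in> {1..n}" for m
      using range[OF that] by auto
    show ?thesis
      unfolding mesh12_occurrences_def R by (force simp: numeral_2_eq_2)
  qed
  have "(s, t) \<in> mesh12_occurrences R n \<pi> \<longleftrightarrow> s \<in> min_successions n \<pi> \<and> t = Suc s" for s t
  proof
    assume "(s, t) \<in> mesh12_occurrences R n \<pi>"
    then have st: "s \<in> {1..n}" "t \<in> {1..n}" "s < t" "\<pi> s < \<pi> t"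
      and empty: "\<And>m. m \<in> {1..n} \<Longrightarrow> \<not> (m < s \<and> \<pi> m < \<pi> s) \<and>
         \<not> (m < s \<and> \<pi> s < \<pi> m \<and> \<pi> m < \<pi> t) \<and>
         \<not> (s < m \<and> m < t \<and> \<pi> m < \<pi> s) \<and> \<not> (s < m \<and> m < t \<and> \<pi> s < \<pi> m \<and> \<pi> m < \<pi> t) \<and>
         \<not> (s < m \<and> m < t \<and> \<pi> t < \<pi> m) \<and> \<not> (t < m \<and> \<pi> s < \<pi> m \<and> \<pi> m < \<pi> t)"
      unfolding occ by blast+
    have t: "t = Suc s"
    proof (rule ccontr)
      assume "t \<noteq> Suc s"
      then have "Suc s \<in> {1..n}" "Suc s < t" "\<pi> (Suc s) \<noteq> \<pi> s" "\<pi> (Suc s) \<noteq> \<pi> t"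
        using st inj by auto
      then show False
        using empty[of "Suc s"] by linarith
    qed
    have succ: "\<pi> t = Suc (\<pi> s)"
    proof (rule ccontr)
      assume neq: "\<pi> t \<noteq> Suc (\<pi> s)"
      have "Suc (\<pi> s) \<in> {1..n}"
        using st range[of t] by simp
      then obtain m where m: "m \<in> {1..n}" "\<pi> m = Suc (\<pi> s)"
        using permutes_image[OF \<pi>] by (metis imageE)
      have "m \<noteq> s" "m \<noteq> t"
        using m neq by auto
      then have "m < s \<or> t < m"
        using t by linarith
      moreover have "\<pi> s < \<pi> m" "\<pi> m < \<pi> t"
        using m(2) neq st(4) by linarith+
      ultimately show False
        using empty[OF m(1)] by blast
    qed
    have "\<pi> s < \<pi> m" if "m \<in> {1..<s}" for m
    proof -
      have "m \<in> {1..n}" "m < s" "\<pi> m \<noteq> \<pi> s"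
        using that st(1) inj by auto
      then show ?thesis
        using empty[of m] by (meson linorder_neqE_nat)
    qed
    then show "s \<in> min_successions n \<pi> \<and> t = Suc s"
      using st t succ by (auto simp: min_successions_def)
  next
    assume "s \<in> min_successions n \<pi> \<and> t = Suc s"
    then have s: "s \<in> {1..<n}" "t = Suc s" "\<pi> t = Suc (\<pi> s)"
      and lrmin: "\<And>m. m \<in> {1..<s} \<Longrightarrow> \<pi> s < \<pi> m"
      by (auto simp: min_successions_def)
    have "\<not> (m < s \<and> \<pi> m < \<pi> s)" if "m \<in> {1..n}" for m
      using lrmin[of m] that by auto
    then show "(s, t) \<in> mesh12_occurrences R n \<pi>"
      unfolding occ using s by auto
  qed
  then show ?thesis
    by auto
qed

lemma card_mesh12_occurrences:
  assumes "R = {(0,0), (0,1), (1,0), (1,1), (1,2), (2,1)}" "\<pi> permutes {1..n}"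
  shows "card (mesh12_occurrences R n \<pi>) = card (min_successions n \<pi>)"
  unfolding mesh12_occurrences_eq[OF assms] by (rule card_image) (simp add: inj_on_def)

section \<open>Decomposing a permutation by its last entry\<close>

text \<open>
  A permutation of \<open>insert a S\<close> factors uniquely as \<open>c j \<circ> \<sigma>\<close> with \<open>j = \<pi> a\<close>, because
  \<open>inv (c j) \<circ> \<pi>\<close> fixes \<open>a\<close>. The coset representatives \<open>c j\<close> are left free here: transpositions
  would do for counting, but only representatives that are monotone on \<open>S\<close> preserve the
  relative order of the entries on \<open>S\<close>.
\<close>

lemma sum_permutations_by_value_at:
  fixes f :: "('a \<Rightarrow> 'a) \<Rightarrow> 'b::comm_monoid_add"
  assumes "finite S" "a \<notin> S"
    and c: "\<And>j. j \<in> insert a S \<Longrightarrow> c j permutes insert a S"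
    and ca: "\<And>j. j \<in> insert a S \<Longrightarrow> c j a = j"
  shows "(\<Sum>\<pi> | \<pi> permutes insert a S. f \<pi>) =
         (\<Sum>\<sigma> | \<sigma> permutes S. \<Sum>j\<in>insert a S. f (c j \<circ> \<sigma>))"
proof -
  let ?A = "{\<sigma>. \<sigma> permutes S} \<times> insert a S"
  have fix_a: "\<sigma> a = a" if "\<sigma> permutes S" for \<sigma>
    using that assms(2) by (simp add: permutes_def)
  have "(\<Sum>\<pi> | \<pi> permutes insert a S. f \<pi>) = (\<Sum>(\<sigma>, j)\<in>?A. f (c j \<circ> \<sigma>))"
  proof (rule sum.reindex_bij_witness[of _ "\<lambda>(\<sigma>, j). c j \<circ> \<sigma>" "\<lambda>\<pi>. (inv (c (\<pi> a)) \<circ> \<pi>, \<pi> a)"])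
    fix \<pi> assume "\<pi> \<in> {\<pi>. \<pi> permutes insert a S}"
    then have \<pi>: "\<pi> permutes insert a S" by simp
    then have j: "\<pi> a \<in> insert a S"
      by (metis insertI1 permutes_in_image)
    note cj = c[OF j]
    show eq: "(case (inv (c (\<pi> a)) \<circ> \<pi>, \<pi> a) of (\<sigma>, j) \<Rightarrow> c j \<circ> \<sigma>) = \<pi>"
      using permutes_inverses(1)[OF cj] by (auto simp: fun_eq_iff)
    have p: "(inv (c (\<pi> a)) \<circ> \<pi>) permutes insert a S"
      using \<pi> permutes_inv[OF cj] by (rule permutes_compose)
    have "(inv (c (\<pi> a)) \<circ> \<pi>) a = a"
      using permutes_inverses(2)[OF cj, of a] ca[OF j] by simp
    then have "(inv (c (\<pi> a)) \<circ> \<pi>) permutes S"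
      using p by (intro permutes_superset[OF p]) auto
    then show "(inv (c (\<pi> a)) \<circ> \<pi>, \<pi> a) \<in> ?A"
      using j by simp
    show "(case (inv (c (\<pi> a)) \<circ> \<pi>, \<pi> a) of (\<sigma>, j) \<Rightarrow> f (c j \<circ> \<sigma>)) = f \<pi>"
      using eq by simp
  next
    fix y assume "y \<in> ?A"
    then obtain \<sigma> j where y: "y = (\<sigma>, j)" and \<sigma>: "\<sigma> permutes S" and j: "j \<in> insert a S"
      by auto
    show "(case y of (\<sigma>, j) \<Rightarrow> c j \<circ> \<sigma>) \<in> {\<pi>. \<pi> permutes insert a S}"
      using permutes_compose[OF permutes_subset[OF \<sigma>] c[OF j]] y by auto
    show "(inv (c ((case y of (\<sigma>, j) \<Rightarrow> c j \<circ> \<sigma>) a)) \<circ> (case y of (\<sigma>, j) \<Rightarrow> c j \<circ> \<sigma>),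
           (case y of (\<sigma>, j) \<Rightarrow> c j \<circ> \<sigma>) a) = y"
      using y fix_a[OF \<sigma>] ca[OF j] permutes_inverses(2)[OF c[OF j]] by (auto simp: fun_eq_iff)
  qed
  also have "\<dots> = (\<Sum>\<sigma> | \<sigma> permutes S. \<Sum>j\<in>insert a S. f (c j \<circ> \<sigma>))"
    by (simp add: sum.cartesian_product)
  finally show ?thesis .
qed

text \<open>
  The cycle that takes the place \<open>Suc n\<close> to \<open>j\<close> and is increasing on \<open>{1..n}\<close>; composing it with
  a permutation of \<open>{1..n}\<close> appends the entry \<open>j\<close>.
\<close>

definition raise_from :: "nat \<Rightarrow> nat \<Rightarrow> nat \<Rightarrow> nat" where
  "raise_from n j v = (if v = Suc n then j else if j \<le> v \<and> v \<le> n then Suc v else v)"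

lemma raise_from_last [simp]: "raise_from n j (Suc n) = j"
  by (simp add: raise_from_def)

lemma raise_from_le: "v \<le> n \<Longrightarrow> raise_from n j v = (if j \<le> v then Suc v else v)"
  by (simp add: raise_from_def)

lemma raise_from_permutes:
  assumes "j \<in> {1..Suc n}"
  shows "raise_from n j permutes {1..Suc n}"
proof (rule bij_imp_permutes)
  have "inj_on (raise_from n j) {1..Suc n}"
    by (auto simp: inj_on_def raise_from_def split: if_splits)
  moreover have "raise_from n j ` {1..Suc n} \<subseteq> {1..Suc n}"
    using assms by (auto simp: raise_from_def)
  ultimately show "bij_betw (raise_from n j) {1..Suc n} {1..Suc n}"
    by (simp add: bij_betw_def endo_inj_surj)
qed (use assms in \<open>auto simp: raise_from_def\<close>)

lemma sum_permutations_by_last: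
  "(\<Sum>\<pi> | \<pi> permutes {1..Suc n}. f \<pi>) =
   (\<Sum>\<sigma> | \<sigma> permutes {1..n}. \<Sum>j\<in>{1..Suc n}. f (raise_from n j \<circ> \<sigma>))"
proof -
  have "{1..Suc n} = insert (Suc n) {1..n}"
    by auto
  then show ?thesis
    using sum_permutations_by_value_at[of "{1..n}" "Suc n" "raise_from n" f]
      raise_from_permutes[of _ n] by simp
qed

section \<open>The effect of the last entry on the statistic\<close>

text \<open>
  Raising is strictly increasing, so it keeps all comparisons among the first \<open>n\<close> entries. As it omits
  exactly the value \<open>j\<close>, it cannot make two values consecutive, and it separates \<open>v\<close> from \<open>v + 1\<close>
  only for \<open>j = v + 1\<close>. At position \<open>n\<close> a new succession needs \<open>j = \<sigma> n + 1\<close>, and a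
  left-to-right minimum in the last place of \<open>\<sigma>\<close> is the value \<open>1\<close>.
\<close>

lemma min_successions_raise_from:
  assumes \<sigma>: "\<sigma> permutes {1..n}" and "n \<ge> 1" and j: "j \<in> {1..Suc n}"
  shows "min_successions (Suc n) (raise_from n j \<circ> \<sigma>) =
         {s \<in> min_successions n \<sigma>. Suc (\<sigma> s) \<noteq> j} \<union> (if \<sigma> n = 1 \<and> j = 2 then {n} else {})"
proof (rule set_eqI)
  fix s
  let ?\<pi> = "raise_from n j \<circ> \<sigma>"
  have range: "1 \<le> \<sigma> m" "\<sigma> m \<le> n" if "1 \<le> m" "m \<le> n" for m
    using permutes_in_image[OF \<sigma>, of m] that by auto
  have val: "?\<pi> m = (if j \<le> \<sigma> m then Suc (\<sigma> m) else \<sigma> m)" if "1 \<le> m" "m \<le> n" for m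
    using range[OF that] by (simp add: raise_from_le)
  have last: "?\<pi> (Suc n) = j"
    using permutes_not_in[OF \<sigma>, of "Suc n"] by simp
  have less: "?\<pi> a < ?\<pi> b \<longleftrightarrow> \<sigma> a < \<sigma> b" if "1 \<le> a" "a \<le> n" "1 \<le> b" "b \<le> n" for a b
    unfolding val[OF that(1,2)] val[OF that(3,4)] by auto
  have lrmin: "(\<forall>m \<in> {1..<s}. ?\<pi> s < ?\<pi> m) \<longleftrightarrow> (\<forall>m \<in> {1..<s}. \<sigma> s < \<sigma> m)"
    if "1 \<le> s" "s \<le> n" for s
    using less that by (intro ball_cong) auto
  consider "s = 0 \<or> s > n" | "1 \<le> s" "s < n" | "s = n"
    by linarith
  then show "s \<in> min_successions (Suc n) ?\<pi> \<longleftrightarrow>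
      s \<in> {s \<in> min_successions n \<sigma>. Suc (\<sigma> s) \<noteq> j} \<union> (if \<sigma> n = 1 \<and> j = 2 then {n} else {})"
  proof cases
    case 1
    then show ?thesis
      using \<open>n \<ge> 1\<close> by (auto simp: min_successions_def)
  next
    case 2
    have "?\<pi> (Suc s) = Suc (?\<pi> s) \<longleftrightarrow> \<sigma> (Suc s) = Suc (\<sigma> s) \<and> Suc (\<sigma> s) \<noteq> j"
      using val[of s] val[of "Suc s"] 2 by auto
    then show ?thesis
      using 2 lrmin[of s] by (auto simp: min_successions_def simp del: o_apply)
  next
    case 3
    have "?\<pi> (Suc n) = Suc (?\<pi> n) \<longleftrightarrow> j = Suc (\<sigma> n)"
      using last val[of n] \<open>n \<ge> 1\<close> by auto
    moreover have "(\<forall>m \<in> {1..<n}. \<sigma> n < \<sigma> m) \<longleftrightarrow> \<sigma> n = 1"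
    proof
      assume min: "\<forall>m \<in> {1..<n}. \<sigma> n < \<sigma> m"
      have "1 \<in> \<sigma> ` {1..n}"
        using permutes_image[OF \<sigma>] \<open>n \<ge> 1\<close> by simp
      then obtain m where "m \<in> {1..n}" "\<sigma> m = 1"
        by (metis imageE)
      then show "\<sigma> n = 1"
        using bspec[OF min, of m] range(1)[of n] \<open>n \<ge> 1\<close> by (cases "m = n") auto
    next
      assume one: "\<sigma> n = 1"
      show "\<forall>m \<in> {1..<n}. \<sigma> n < \<sigma> m"
      proof
        fix m assume m: "m \<in> {1..<n}"
        then have "\<sigma> m \<noteq> \<sigma> n"
          using injD[OF permutes_inj[OF \<sigma>], of m n] by auto
        then show "\<sigma> n < \<sigma> m"
          using one range(1)[of m] m by simp
      qed
    qed
    ultimately show ?thesis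
      using 3 lrmin[of n] \<open>n \<ge> 1\<close> by (auto simp: min_successions_def simp del: o_apply)
  qed
qed

definition min_succession_poly :: "nat \<Rightarrow> int poly" where
  "min_succession_poly n = (\<Sum>\<pi> | \<pi> permutes {1..n}. monom 1 (card (min_successions n \<pi>)))"

text \<open>
  The destroying choices of \<open>j\<close> are the \<open>k\<close> values \<open>\<sigma> s + 1\<close> with \<open>s\<close> an occurrence. The creating
  choice \<open>j = 2\<close> is never one of them: it would need \<open>\<sigma> s = 1 = \<sigma> n\<close>, but \<open>s < n\<close>. Hence the two effects
  add up independently.
\<close>

lemma sum_last_entry:
  assumes \<sigma>: "\<sigma> permutes {1..n}" and n: "n \<ge> 1"
  defines "k \<equiv> card (min_successions n \<sigma>)"
  shows "(\<Sum>j\<in>{1..Suc n}. monom (1::int) (card (min_successions (Suc n) (raise_from n j \<circ> \<sigma>)))) =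
         of_nat (Suc n) * monom 1 k + (1 - [:0, 1:]) * pderiv (monom 1 k)
         + (if \<sigma> n = 1 then ([:0, 1:] - 1) * monom 1 k else 0)"
proof -
  \<comment> \<open>the last entries that destroy an occurrence of \<open>\<sigma>\<close>\<close>
  define D where "D = (\<lambda>s. Suc (\<sigma> s)) ` min_successions n \<sigma>"
  have inj: "inj \<sigma>"
    by (rule permutes_inj[OF \<sigma>])
  have cardD: "card D = k"
    unfolding D_def k_def
    by (rule card_image) (use inj in \<open>auto simp: inj_on_def dest: injD\<close>)
  have D: "D \<subseteq> {1..Suc n}"
    using permutes_in_image[OF \<sigma>] by (force simp: D_def min_successions_def)
  have card: "monom (1::int) (card (min_successions (Suc n) (raise_from n j \<circ> \<sigma>))) =
      monom 1 k + (if j \<in> D then monom 1 (k - 1) - monom 1 k else 0)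
      + (if j = 2 then (if \<sigma> n = 1 then ([:0, 1:] - 1) * monom 1 k else 0) else 0)"
    if j: "j \<in> {1..Suc n}" for j
  proof (cases "j \<in> D")
    case True
    then obtain s where s: "s \<in> min_successions n \<sigma>" "j = Suc (\<sigma> s)"
      by (auto simp: D_def)
    have "{u \<in> min_successions n \<sigma>. Suc (\<sigma> u) \<noteq> j} = min_successions n \<sigma> - {s}"
      using s injD[OF inj] by auto
    moreover have "\<not> (\<sigma> n = 1 \<and> j = 2)"
      using s injD[OF inj, of s n] by (auto simp: min_successions_def)
    ultimately show ?thesis
      using min_successions_raise_from[OF \<sigma> n j] s True by (auto simp: k_def)
  next
    case False
    then have "{u \<in> min_successions n \<sigma>. Suc (\<sigma> u) \<noteq> j} = min_successions n \<sigma>"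
      by (auto simp: D_def)
    moreover have "n \<notin> min_successions n \<sigma>"
      by (simp add: min_successions_def)
    ultimately show ?thesis
      using min_successions_raise_from[OF \<sigma> n j] False
      by (auto simp: k_def monom_Suc algebra_simps)
  qed
  have two: "2 \<in> {1..Suc n}"
    using n by simp
  have "pderiv (monom (1::int) k) = of_nat k * monom 1 (k - 1)"
    by (simp add: pderiv_monom of_nat_poly smult_monom)
  moreover have "[:0, 1:] * (of_nat k * monom (1::int) (k - 1)) = of_nat k * monom 1 k"
    by (cases k) (simp_all add: monom_Suc)
  moreover have "(\<Sum>j\<in>{1..Suc n}. monom (1::int) (card (min_successions (Suc n) (raise_from n j \<circ> \<sigma>)))) =
      of_nat (Suc n) * monom 1 k + of_nat k * (monom 1 (k - 1) - monom 1 k)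
      + (if \<sigma> n = 1 then ([:0, 1:] - 1) * monom 1 k else 0)"
  proof -
    have "(\<Sum>j\<in>{1..Suc n}. monom (1::int) (card (min_successions (Suc n) (raise_from n j \<circ> \<sigma>)))) =
      (\<Sum>j\<in>{1..Suc n}. monom 1 k)
      + (\<Sum>j\<in>{1..Suc n}. if j \<in> D then monom 1 (k - 1) - monom 1 k else 0)
      + (\<Sum>j\<in>{1..Suc n}. if j = 2
           then (if \<sigma> n = 1 then ([:0, 1:] - 1) * monom 1 k else 0) else 0)"
      by (simp only: sum.distrib[symmetric] card cong: sum.cong)
    moreover have "(\<Sum>j\<in>{1..Suc n}. monom (1::int) k) = of_nat (Suc n) * monom 1 k"
      by simp
    moreover have "(\<Sum>j\<in>{1..Suc n}. if j \<in> D then monom (1::int) (k - 1) - monom 1 k else 0)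
        = of_nat k * (monom 1 (k - 1) - monom 1 k)"
      using D cardD by (simp add: sum.If_cases Int_absorb1 Int_absorb2 del: sum.cl_ivl_Suc)
    ultimately show ?thesis
      using two by (simp only: sum.delta finite_atLeastAtMost if_True)
  qed
  ultimately show ?thesis
    by (simp add: algebra_simps del: of_nat_Suc sum.cl_ivl_Suc)
qed

section \<open>The recurrence for the generating polynomials\<close>

text \<open>
  Appending \<open>1\<close> raises all values by one: no two consecutive values are separated, and the appended
  entry is the successor of none.
\<close>

lemma sum_last_entry_one:
  "(\<Sum>\<sigma> | \<sigma> permutes {1..Suc n} \<and> \<sigma> (Suc n) = 1. monom (1::int) (card (min_successions (Suc n) \<sigma>)))
    = min_succession_poly n"
proof (cases "n = 0")
  case True
  have "{\<sigma>. \<sigma> permutes {1..Suc 0} \<and> \<sigma> (Suc 0) = 1} = {id}"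
    by (auto simp: permutes_sing)
  then show ?thesis
    using True by (simp add: min_succession_poly_def min_successions_def)
next
  case False
  have fin: "finite {\<sigma>. \<sigma> permutes {1..m}}" for m :: nat
    by (simp add: finite_permutations)
  let ?w = "\<lambda>\<sigma>. if \<sigma> (Suc n) = 1 then monom (1::int) (card (min_successions (Suc n) \<sigma>)) else 0"
  have inner: "(\<Sum>j\<in>{1..Suc n}. ?w (raise_from n j \<circ> \<sigma>)) = monom 1 (card (min_successions n \<sigma>))"
    if \<sigma>: "\<sigma> permutes {1..n}" for \<sigma>
  proof -
    have last: "(raise_from n j \<circ> \<sigma>) (Suc n) = j" for j
      using permutes_not_in[OF \<sigma>, of "Suc n"] by simp
    have "\<sigma> s \<noteq> 0" if "s \<in> min_successions n \<sigma>" for s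
      using permutes_in_image[OF \<sigma>, of s] that by (auto simp: min_successions_def)
    then have "min_successions (Suc n) (raise_from n 1 \<circ> \<sigma>) = min_successions n \<sigma>"
      using False min_successions_raise_from[OF \<sigma>, of 1] by auto
    moreover have "(\<Sum>j\<in>{1..Suc n}. ?w (raise_from n j \<circ> \<sigma>)) =
        (\<Sum>j\<in>{1..Suc n}. if j = 1
           then monom 1 (card (min_successions (Suc n) (raise_from n 1 \<circ> \<sigma>))) else 0)"
      unfolding last by (rule sum.cong) auto
    ultimately show ?thesis
      by (simp add: sum.delta del: sum.cl_ivl_Suc)
  qed
  have "(\<Sum>\<sigma> | \<sigma> permutes {1..Suc n} \<and> \<sigma> (Suc n) = 1. monom (1::int) (card (min_successions (Suc n) \<sigma>)))
      = (\<Sum>\<sigma> | \<sigma> permutes {1..Suc n}. ?w \<sigma>)"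
    using fin[of "Suc n"] by (simp add: sum.inter_filter[symmetric])
  also have "\<dots> = (\<Sum>\<sigma> | \<sigma> permutes {1..n}. \<Sum>j\<in>{1..Suc n}. ?w (raise_from n j \<circ> \<sigma>))"
    by (rule sum_permutations_by_last)
  also have "\<dots> = min_succession_poly n"
    unfolding min_succession_poly_def by (rule sum.cong) (use inner in auto)
  finally show ?thesis .
qed

lemma min_succession_poly_Suc_Suc:
  "min_succession_poly (Suc (Suc n)) =
     of_nat (Suc (Suc n)) * min_succession_poly (Suc n)
     + (1 - [:0, 1:]) * pderiv (min_succession_poly (Suc n))
     + ([:0, 1:] - 1) * min_succession_poly n"
proof -
  let ?S = "{\<sigma>. \<sigma> permutes {1..Suc n}}"
  let ?m = "\<lambda>\<sigma>. monom (1::int) (card (min_successions (Suc n) \<sigma>))"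
  have fin: "finite ?S"
    by (simp add: finite_permutations)
  have "min_succession_poly (Suc (Suc n)) =
      (\<Sum>\<sigma>\<in>?S. of_nat (Suc (Suc n)) * ?m \<sigma> + (1 - [:0, 1:]) * pderiv (?m \<sigma>)
         + (if \<sigma> (Suc n) = 1 then ([:0, 1:] - 1) * ?m \<sigma> else 0))"
    unfolding min_succession_poly_def[of "Suc (Suc n)"] sum_permutations_by_last[of _ "Suc n"]
    by (rule sum.cong) (use sum_last_entry[of _ "Suc n"] in auto)
  also have "\<dots> = of_nat (Suc (Suc n)) * (\<Sum>\<sigma>\<in>?S. ?m \<sigma>) + (1 - [:0, 1:]) * pderiv (\<Sum>\<sigma>\<in>?S. ?m \<sigma>)
      + ([:0, 1:] - 1) * (\<Sum>\<sigma> | \<sigma> permutes {1..Suc n} \<and> \<sigma> (Suc n) = 1. ?m \<sigma>)"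
  proof -
    have "(\<Sum>\<sigma>\<in>?S. if \<sigma> (Suc n) = 1 then ([:0, 1:] - 1) * ?m \<sigma> else 0) =
        (\<Sum>\<sigma> | \<sigma> permutes {1..Suc n} \<and> \<sigma> (Suc n) = 1. ([:0, 1:] - 1) * ?m \<sigma>)"
      using fin by (simp add: sum.inter_filter[symmetric])
    moreover have "pderiv (\<Sum>\<sigma>\<in>?S. ?m \<sigma>) = (\<Sum>\<sigma>\<in>?S. pderiv (?m \<sigma>))"
      using higher_pderiv_sum[of 1 ?m ?S] by simp
    ultimately show ?thesis
      by (simp only: sum.distrib sum_distrib_left)
  qed
  also have "\<dots> = of_nat (Suc (Suc n)) * min_succession_poly (Suc n)
      + (1 - [:0, 1:]) * pderiv (min_succession_poly (Suc n))
     + ([:0, 1:] - 1) * min_succession_poly n"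
    unfolding sum_last_entry_one by (simp only: min_succession_poly_def)
  finally show ?thesis .
qed

lemma min_succession_poly_0: "min_succession_poly 0 = 1"
  by (simp add: min_succession_poly_def min_successions_def)

lemma min_succession_poly_1: "min_succession_poly (Suc 0) = 1"
  by (simp add: min_succession_poly_def min_successions_def permutes_sing)

lemma min_succession_poly_2: "min_succession_poly (Suc (Suc 0)) = 1 + [:0, 1:]"
  using min_succession_poly_Suc_Suc[of 0]
  by (simp add: min_succession_poly_0 min_succession_poly_1)

section \<open>Transfer to the counting numbers\<close>

lemma mesh12_count_eq_coeff:
  assumes R: "R = {(0,0), (0,1), (1,0), (1,1), (1,2), (2,1)}"
  shows "int (mesh12_count R n k) = (if k < 0 then 0 else coeff (min_succession_poly n) (nat k))"
proof (cases "k < 0")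
  case True
  then show ?thesis
    by (simp add: mesh12_count_def)
next
  case False
  have "mesh12_count R n k =
      card {\<pi>. \<pi> permutes {1..n} \<and> card (min_successions n \<pi>) = nat k}"
    unfolding mesh12_count_def using False card_mesh12_occurrences[OF R]
    by (intro arg_cong[where f = card]) auto
  moreover have "coeff (min_succession_poly n) (nat k) =
      (\<Sum>\<pi> | \<pi> permutes {1..n}. if card (min_successions n \<pi>) = nat k then 1 else 0)"
    by (simp add: min_succession_poly_def coeff_sum)
  ultimately show ?thesis
    using False by (simp add: sum.inter_filter[symmetric] finite_permutations)
qed

lemma mesh12_poly_eq:
  assumes R: "R = {(0,0), (0,1), (1,0), (1,1), (1,2), (2,1)}" and "n \<ge> 1"
  shows "mesh12_poly R n = min_succession_poly n"
proof (rule poly_eqI)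
  fix k
  have "coeff (min_succession_poly n) k = 0" if "k \<ge> n"
  proof -
    have "card (min_successions n \<pi>) \<noteq> k" for \<pi>
      using card_min_successions_less[OF \<open>n \<ge> 1\<close>, of \<pi>] that by simp
    then show ?thesis
      by (simp add: min_succession_poly_def coeff_sum)
  qed
  then show "coeff (mesh12_poly R n) k = coeff (min_succession_poly n) k"
    by (simp add: mesh12_poly_def coeff_sum mesh12_count_eq_coeff[OF R])
qed

theorem theorem4p3:
  fixes R :: "(nat \<times> nat) set" and T :: "nat \<Rightarrow> int \<Rightarrow> int" and P :: "nat \<Rightarrow> int poly"
    and x :: "int poly"
  assumes R: "R = {(0,0), (0,1), (1,0), (1,1), (1,2), (2,1)}"
    and T: "\<And>n k. T n k = int (mesh12_count R n k)"
    and P: "\<And>n. P n = mesh12_poly R n"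
    and x: "x = [:0, 1:]"
  shows "(\<forall>n::nat. \<forall>k::int. n \<ge> 3 \<and> k \<ge> 0 \<longrightarrow>
            T n k = (k + 1) * T (n - 1) (k + 1) + (int n - k) * T (n - 1) k
                    - T (n - 2) k + T (n - 2) (k - 1))
         \<and> T 1 0 = 1 \<and> T 2 0 = 1 \<and> T 2 1 = 1
         \<and> (\<forall>n::nat. n \<ge> 3 \<longrightarrow>
            P n = of_nat n * P (n - 1) + (1 - x) * pderiv (P (n - 1)) + (x - 1) * P (n - 2))
         \<and> P 1 = 1 \<and> P 2 = 1 + x"
proof -
  let ?G = min_succession_poly
  have T_coeff: "T n k = (if k < 0 then 0 else coeff (?G n) (nat k))" for n k
    unfolding T by (rule mesh12_count_eq_coeff[OF R])
  have P_eq: "P n = ?G n" if "n \<ge> 1" for n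
    unfolding P using R that by (rule mesh12_poly_eq)
  have rec: "?G n = of_nat n * ?G (n - 1) + (1 - x) * pderiv (?G (n - 1)) + (x - 1) * ?G (n - 2)"
    if "n \<ge> 2" for n
    using min_succession_poly_Suc_Suc[of "n - 2"] that unfolding x
    by (simp add: Suc_diff_le numeral_2_eq_2 Suc_diff_Suc)
  have x_mult: "x * p = pCons 0 p" for p
    by (simp add: x)
  have T_rec: "T n k = (k + 1) * T (n - 1) (k + 1) + (int n - k) * T (n - 1) k
      - T (n - 2) k + T (n - 2) (k - 1)" if n: "n \<ge> 3" and k: "k \<ge> 0" for n k
  proof -
    obtain i where i: "k = int i"
      using k nonneg_int_cases by blast
    have "coeff (?G n) i = int n * coeff (?G (n - 1)) i
        + (int (Suc i) * coeff (?G (n - 1)) (Suc i) - int i * coeff (?G (n - 1)) i)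
        + (coeff (pCons 0 (?G (n - 2))) i - coeff (?G (n - 2)) i)"
    proof -
      have "coeff (pCons 0 (pderiv q)) i = int i * coeff q i" for q :: "int poly"
        by (cases i) (simp_all add: coeff_pderiv)
      then show ?thesis
        using n by (subst rec)
          (simp_all add: left_diff_distrib x_mult coeff_pderiv of_nat_poly)
    qed
    then show ?thesis
      unfolding T_coeff i by (cases i) (simp_all add: nat_add_distrib algebra_simps)
  qed
  have P1: "P 1 = 1" and P2: "P 2 = 1 + x"
    by (simp_all add: P_eq min_succession_poly_1 min_succession_poly_2 numeral_2_eq_2 x)
  have "T 1 0 = 1" "T 2 0 = 1" "T 2 1 = 1"
    by (simp_all add: T_coeff min_succession_poly_1 min_succession_poly_2 numeral_2_eq_2)
  moreover have "P n = of_nat n * P (n - 1) + (1 - x) * pderiv (P (n - 1)) + (x - 1) * P (n - 2)"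
    if "n \<ge> 3" for n
    using that by (simp only: P_eq rec)
  ultimately show ?thesis
    using T_rec P1 P2 by blast
qed

end
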